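(* The functions $\tilde K_0$ and $\tilde H_0$ satisfy, for all real $s_1,s_2$ (with the removable singularities at $s_1=0$, $s_2=0$, $s_1+s_2=0$ understood by continuity), the identity $$-\frac12\tilde H_0(s_1,s_2)=\frac{\tilde K_0(s_2)-\tilde K_0(s_1)}{s_1+s_2}+\frac{\tilde K_0(s_1+s_2)-\tilde K_0(s_2)}{s_1}-\frac{\tilde K_0(s_1+s_2)-\tilde K_0(s_1)}{s_2}.$$
   Context: The functions are defined by $$\tilde K_0(s)=4\frac{\sinh(s/2)}{s}K_0(s),\qquad K_0(s)=\frac{-2+s\coth(s/2)}{s\sinh(s/2)},$$ $$\tilde H_0(s,t)=4\frac{\sinh((s+t)/2)}{s+t}H_0(s,t),$$ $$H_0(s,t)=\frac{t(s+t)\cosh s-s(s+t)\cosh t+(s-t)(s+t+\sinh s+\sinh t-\sinh(s+t))}{st(s+t)\sinh(\frac s2)\sinh(\frac t2)\sinh^2(\frac{s+t}2)},$$ all extended smoothly through their removable singularities. *)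

theory Defs
  imports "HOL-Analysis.Analysis"
begin

definition coth :: "real \<Rightarrow> real" where
  "coth x = cosh x / sinh x"

(* Extension by continuity: f is given by a formula that is meaningful on a dense set D only.
   Off D the value is the limit along D; Lim is arbitrary if that limit does not exist. *)
definition ext_by_cont :: "'a::topological_space set \<Rightarrow> ('a \<Rightarrow> real) \<Rightarrow> 'a \<Rightarrow> real" where
  "ext_by_cont D f x = (if x \<in> D then f x else Lim (at x within D) f)"

definition K0 :: "real \<Rightarrow> real" where
  "K0 = ext_by_cont {s. s \<noteq> 0}
     (\<lambda>s. (- 2 + s * coth (s / 2)) / (s * sinh (s / 2)))"

definition Kt0 :: "real \<Rightarrow> real" where
  "Kt0 = ext_by_cont {s. s \<noteq> 0} (\<lambda>s. 4 * (sinh (s / 2) / s) * K0 s)"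

definition regular_pairs :: "(real \<times> real) set" where
  "regular_pairs = {(s, t). s \<noteq> 0 \<and> t \<noteq> 0 \<and> s + t \<noteq> 0}"

definition H0 :: "real \<times> real \<Rightarrow> real" where
  "H0 = ext_by_cont regular_pairs
     (\<lambda>(s, t).
        (t * (s + t) * cosh s - s * (s + t) * cosh t
          + (s - t) * (s + t + sinh s + sinh t - sinh (s + t)))
        / (s * t * (s + t) * sinh (s / 2) * sinh (t / 2) * (sinh ((s + t) / 2))\<^sup>2))"

(* Here only s + t = 0 needs a limit, since H0 is already extended. *)
definition Ht0 :: "real \<times> real \<Rightarrow> real" where
  "Ht0 = ext_by_cont {(s, t). s + t \<noteq> 0}
     (\<lambda>(s, t). 4 * (sinh ((s + t) / 2) / (s + t)) * H0 (s, t))"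

end

theory Submission
  imports Defs
begin

text \<open>
  For nonzero \<open>s\<close> the function \<open>Kt0 s\<close> equals \<open>4 * (s * coth (s / 2) - 2) / s\<^sup>2\<close>. It is even and,
  once extended to \<open>0\<close>, continuously differentiable: numerator and denominator, rewritten in
  terms of \<open>exp\<close>, both vanish to third order at \<open>0\<close>, and dividing \<open>s ^ 3\<close> out leaves
  remainders of the exponential series (\<open>Kt0_exp_rem\<close>, \<open>Kt0_C1\<close>).

  Evenness turns the right-hand side of the identity into a combination of three divided
  differences of \<open>Kt0\<close>, the first one over the nodes \<open>t\<close> and \<open>- s\<close>, whose difference is
  \<open>s + t\<close>. Divided differences of a continuously differentiable function extend continuously
  to the diagonal (\<open>continuous_on_divdiff\<close>, \<open>divdiff_eq\<close>), so the right-hand side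
  extends to a continuous function \<open>F\<close> on the whole plane.

  Where no denominator vanishes the identity is one of hyperbolic functions. Both sides are linear
  combinations of \<open>coth (s / 2)\<close>, \<open>coth (t / 2)\<close>, \<open>coth ((s + t) / 2)\<close> and \<open>1\<close> over
  a common denominator (\<open>numerator_eq\<close>, \<open>Kt0_differences\<close>, \<open>regular_identity\<close>). Such points
  are dense, and a continuous function is the extension of its restriction to any dense set
  (\<open>ext_by_cont_eq\<close>). Hence each extension occurring in the definitions is the expected
  expression in \<open>F\<close>; in particular \<open>Ht0 = - 2 * F\<close> everywhere.
\<close>

section \<open>Extension by continuity\<close>

lemma ext_by_cont_eq:
  fixes F :: "'a::t1_space \<Rightarrow> real"
  assumes F: "continuous_on UNIV F" and dense: "closure D = UNIV"
    and eq: "\<And>x. x \<in> D \<Longrightarrow> f x = F x"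
  shows "ext_by_cont D f = F"
proof
  fix x
  show "ext_by_cont D f x = F x"
  proof (cases "x \<in> D")
    case True
    then show ?thesis by (simp add: ext_by_cont_def eq)
  next
    case False
    with dense have "x islimpt D"
      by (auto simp: closure_def)
    then have nontrivial: "at x within D \<noteq> bot"
      by (simp add: trivial_limit_within)
    have "(F \<longlongrightarrow> F x) (at x within D)"
      using F by (auto simp: continuous_on_def intro: tendsto_within_subset)
    then have "(f \<longlongrightarrow> F x) (at x within D)"
      by (rule Lim_transform_eventually) (auto simp: eventually_at_filter eq)
    with nontrivial False show ?thesis
      by (simp add: ext_by_cont_def tendsto_Lim)
  qed
qed

lemma closure_nonzero: "closure {s::real. s \<noteq> 0} = UNIV"
proof -
  have "{s::real. s \<noteq> 0} = - {0}" by auto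
  then show ?thesis by (simp add: closure_complement)
qed

text \<open>Moving a point along the diagonal direction meets each of the three excluded lines only once,
  so arbitrarily small moves lead into \<open>regular_pairs\<close>.\<close>

lemma closure_regular_pairs: "closure regular_pairs = UNIV"
proof -
  have "(a, b) \<in> closure regular_pairs" for a b :: real
  proof (rule Lim_in_closed_set[OF closed_closure])
    have "\<forall>\<^sub>F e in at 0. e \<noteq> - a \<and> e \<noteq> - b \<and> e \<noteq> - (a + b) / 2"
      by (intro eventually_conj eventually_neq_at_within)
    then show "\<forall>\<^sub>F e in at (0::real). (a + e, b + e) \<in> closure regular_pairs"
    proof eventually_elim
      case (elim e)
      then have "(a + e, b + e) \<in> regular_pairs"
        by (auto simp: regular_pairs_def)
      then show ?case using closure_subset by blast
    qed
    show "((\<lambda>e. (a + e, b + e)) \<longlongrightarrow> (a, b)) (at 0)"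
      by (auto intro!: tendsto_eq_intros)
  qed simp
  then show ?thesis by auto
qed

section \<open>Divided differences\<close>

text \<open>The argument is the derivative of the function whose differences are formed: the mean of
  the derivative over a segment makes sense on the diagonal as well, and its continuity there needs
  no case distinction.\<close>

definition divdiff :: "(real \<Rightarrow> real) \<Rightarrow> real \<times> real \<Rightarrow> real" where
  "divdiff f' = (\<lambda>(x, y). integral {0..1} (\<lambda>u. f' (y + u * (x - y))))"

lemma continuous_on_divdiff:
  assumes "continuous_on UNIV f'"
  shows "continuous_on UNIV (divdiff f')"
proof -
  have "continuous_on (UNIV \<times> cbox 0 1)
      (\<lambda>(p :: real \<times> real, u). f' (snd p + u * (fst p - snd p)))"
    unfolding case_prod_unfold
    by (intro continuous_on_compose2[OF assms] continuous_intros) auto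
  from integral_continuous_on_param[OF this] show ?thesis
    by (simp add: divdiff_def case_prod_unfold)
qed

lemma divdiff_eq:
  assumes f': "\<And>x. (f has_real_derivative f' x) (at x)" and "x \<noteq> y"
  shows "divdiff f' (x, y) = (f x - f y) / (x - y)"
proof -
  let ?g = "\<lambda>u. f (y + u * (x - y)) / (x - y)"
  have "(?g has_vector_derivative f' (y + u * (x - y))) (at u within {0..1})" for u
    using \<open>x \<noteq> y\<close> unfolding has_real_derivative_iff_has_vector_derivative[symmetric]
    by (auto intro!: derivative_eq_intros DERIV_chain2[OF f'])
  then have "((\<lambda>u. f' (y + u * (x - y))) has_integral (?g 1 - ?g 0)) {0..1}"
    by (intro fundamental_theorem_of_calculus) auto
  then show ?thesis
    by (simp add: divdiff_def integral_unique diff_divide_distrib)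
qed

section \<open>Remainders of the exponential series\<close>

text \<open>The exponential series without its first \<open>j\<close> terms, divided by \<open>x ^ j\<close>. Being
  an everywhere convergent power series it is smooth, including at \<open>0\<close>.\<close>

definition exp_rem :: "nat \<Rightarrow> real \<Rightarrow> real" where
  "exp_rem j x = (\<Sum>n. x ^ n / fact (n + j))"

lemma summable_exp_rem: "summable (\<lambda>n. 1 / fact (n + j) * x ^ n :: real)"
proof (rule summable_comparison_test)
  show "\<exists>N. \<forall>n\<ge>N. norm (1 / fact (n + j) * x ^ n) \<le> \<bar>x\<bar> ^ n / fact n"
    by (auto simp: abs_mult power_abs intro!: divide_left_mono fact_mono)
  show "summable (\<lambda>n. \<bar>x\<bar> ^ n / fact n)"
    using summable_exp[of "\<bar>x\<bar>"] by (simp add: field_simps)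
qed

lemma exp_rem_0: "exp_rem 0 = exp"
  by (auto simp: exp_rem_def exp_def field_simps)

lemma exp_rem_Suc: "x * exp_rem (Suc j) x = exp_rem j x - 1 / fact j"
proof -
  have "exp_rem j x = 1 / fact j + (\<Sum>n. x * (x ^ n / fact (n + Suc j)))"
    using suminf_split_head[OF summable_exp_rem[of j x]] by (simp add: exp_rem_def)
  also have "(\<Sum>n. x * (x ^ n / fact (n + Suc j))) = x * exp_rem (Suc j) x"
    using suminf_mult[OF summable_exp_rem[of "Suc j" x], of x] by (simp add: exp_rem_def)
  finally show ?thesis by simp
qed

lemma exp_rem_at_0: "exp_rem j 0 = 1 / fact j"
  using exp_rem_Suc[of 0 j] by simp

lemma exp_rem_C1:
  obtains d where "\<And>x. (exp_rem j has_real_derivative d x) (at x)" "continuous_on UNIV d"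
proof
  let ?c = "\<lambda>n. 1 / fact (n + j) :: real"
  let ?d = "\<lambda>x. \<Sum>n. diffs ?c n * x ^ n"
  have eq: "exp_rem j = (\<lambda>x. \<Sum>n. ?c n * x ^ n)"
    by (auto simp: exp_rem_def)
  show "(exp_rem j has_real_derivative ?d x) (at x)" for x
    unfolding eq
    by (rule termdiffs_strong_converges_everywhere) (rule summable_exp_rem)
  have "isCont ?d x" for x
    by (rule isCont_powser_converges_everywhere)
      (rule termdiff_converges_all, rule summable_exp_rem)
  then show "continuous_on UNIV ?d"
    by (simp add: continuous_on_eq_continuous_at)
qed

lemma continuous_on_exp_rem: "continuous_on UNIV (exp_rem j)"
  by (rule exp_rem_C1[of j]) (rule DERIV_continuous_on, blast intro: has_field_derivative_at_within)

section \<open>The function of one variable\<close>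

lemma exp_rem_1_nonzero: "exp_rem 1 x \<noteq> 0"
  using exp_rem_Suc[of x 0] exp_rem_at_0[of 1]
  by (cases "x = 0") (auto simp: exp_rem_0)

text \<open>This provides a continuous extension of \<open>sinh (w / 2) / w\<close> without zeros, by which
  one can divide on the line \<open>s + t = 0\<close>.\<close>

lemma sinh_half_over:
  assumes "w \<noteq> 0"
  shows "sinh (w / 2) / w = exp_rem 1 w / (2 * exp (w / 2))"
proof -
  have "exp_rem 1 w = (exp (w / 2) * exp (w / 2) - 1) / w"
    using exp_rem_Suc[of w 0] assms by (simp add: exp_rem_0 exp_add[symmetric] field_simps)
  then show ?thesis
    by (simp add: sinh_def exp_minus field_simps)
qed

text \<open>With \<open>coth (s / 2) = (exp s + 1) / (exp s - 1)\<close> the quotient becomes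
  \<open>4 * (s * (exp s + 1) - 2 * (exp s - 1)) / (s\<^sup>2 * (exp s - 1))\<close>. In the numerator the terms up to
  second order cancel, which leaves \<open>s ^ 3 * (exp_rem 2 s - 2 * exp_rem 3 s)\<close>, while
  \<open>exp s - 1 = s * exp_rem 1 s\<close>.\<close>

lemma exp_rem_quotient:
  assumes "s \<noteq> 0"
  shows "4 * (exp_rem 2 s - 2 * exp_rem 3 s) / exp_rem 1 s = 4 * (s * coth (s / 2) - 2) / s\<^sup>2"
proof -
  define E where "E = exp (s / 2)"
  have E: "E > 0" "exp s = E\<^sup>2" "exp (- (s / 2)) = 1 / E"
    by (simp_all add: E_def exp_double[symmetric] exp_minus field_simps)
  have ne: "E\<^sup>2 - 1 \<noteq> 0"
    using assms E(2) by (metis exp_eq_one_iff eq_iff_diff_eq_0)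
  have coth: "coth (s / 2) = (E\<^sup>2 + 1) / (E\<^sup>2 - 1)"
    using E(1) ne
    by (simp add: coth_def sinh_def cosh_def E(3) E_def[symmetric])
      (simp add: divide_simps power2_eq_square; simp add: algebra_simps)
  have r1: "exp_rem 1 s = (E\<^sup>2 - 1) / s"
    using exp_rem_Suc[of s 0] assms E(2) by (simp add: exp_rem_0 field_simps)
  have r2: "exp_rem 2 s = (exp_rem 1 s - 1) / s"
    using exp_rem_Suc[of s 1] assms by (simp add: numeral_2_eq_2 field_simps)
  have r3: "exp_rem 3 s = (exp_rem 2 s - 1 / 2) / s"
    using exp_rem_Suc[of s 2] assms by (simp add: numeral_3_eq_3 numeral_2_eq_2 field_simps)
  show ?thesis
    using assms ne unfolding r3 r2 r1 coth
    by (simp add: divide_simps power2_eq_square; simp add: algebra_simps)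
qed

lemma Kt0_exp_rem: "Kt0 = (\<lambda>s. 4 * (exp_rem 2 s - 2 * exp_rem 3 s) / exp_rem 1 s)"
  unfolding Kt0_def
proof (rule ext_by_cont_eq[OF _ closure_nonzero])
  show "continuous_on UNIV (\<lambda>s. 4 * (exp_rem 2 s - 2 * exp_rem 3 s) / exp_rem 1 s)"
    using exp_rem_1_nonzero by (intro continuous_intros continuous_on_exp_rem) auto
  fix s :: real assume "s \<in> {s. s \<noteq> 0}"
  then have s: "s \<noteq> 0" by simp
  then show "4 * (sinh (s / 2) / s) * K0 s = 4 * (exp_rem 2 s - 2 * exp_rem 3 s) / exp_rem 1 s"
    unfolding exp_rem_quotient[OF s] by (simp add: K0_def ext_by_cont_def power2_eq_square)
qed

lemma Kt0_nonzero: "s \<noteq> 0 \<Longrightarrow> Kt0 s = 4 * (s * coth (s / 2) - 2) / s\<^sup>2"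
  unfolding Kt0_exp_rem by (rule exp_rem_quotient)

lemma Kt0_even: "Kt0 (- s) = Kt0 s"
  by (cases "s = 0") (auto simp: Kt0_nonzero coth_def)

lemma Kt0_C1:
  obtains d where "\<And>x. (Kt0 has_real_derivative d x) (at x)" "continuous_on UNIV d"
proof -
  obtain d1 d2 d3
    where d: "\<And>x. (exp_rem 1 has_real_derivative d1 x) (at x)"
        "\<And>x. (exp_rem 2 has_real_derivative d2 x) (at x)"
        "\<And>x. (exp_rem 3 has_real_derivative d3 x) (at x)"
      and c: "continuous_on UNIV d1" "continuous_on UNIV d2" "continuous_on UNIV d3"
    by (meson exp_rem_C1)
  let ?d = "\<lambda>x. (4 * (d2 x - 2 * d3 x) * exp_rem 1 x
      - 4 * (exp_rem 2 x - 2 * exp_rem 3 x) * d1 x) / (exp_rem 1 x * exp_rem 1 x)"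
  show thesis
  proof
    show "(Kt0 has_real_derivative ?d x) (at x)" for x
      unfolding Kt0_exp_rem
      by (rule derivative_eq_intros d exp_rem_1_nonzero refl)+ simp
    show "continuous_on UNIV ?d"
      using exp_rem_1_nonzero by (intro continuous_intros c continuous_on_exp_rem) auto
  qed
qed

section \<open>The hyperbolic identity\<close>

lemma sinh_half_sum:
  fixes s t :: real
  shows "sinh s + sinh t - sinh (s + t) = - 4 * sinh (s / 2) * sinh (t / 2) * sinh ((s + t) / 2)"
proof -
  have double: "sinh s = 2 * sinh (s / 2) * cosh (s / 2)" "sinh t = 2 * sinh (t / 2) * cosh (t / 2)"
      "cosh s = 2 * (sinh (s / 2))\<^sup>2 + 1" "cosh t = 2 * (sinh (t / 2))\<^sup>2 + 1"
    using sinh_double[of "s / 2"] sinh_double[of "t / 2"] cosh_double[of "s / 2"] cosh_double[of "t / 2"]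
    by (simp_all add: cosh_square_eq)
  show ?thesis
    unfolding sinh_add[of s t] add_divide_distrib sinh_add[of "s / 2"] double
    by (simp add: power2_eq_square algebra_simps)
qed

text \<open>The numerator of \<open>H0\<close> is thereby cleared of everything but half arguments. After division
  by \<open>S * T * W\<close> the right-hand side contains only hyperbolic cotangents, in the
  combination that \<open>Kt0_differences\<close> produces. The part without the factor \<open>s + t\<close> is
  \<open>sinh_half_sum\<close>; the rest becomes \<open>t * S\<^sup>2 - s * T\<^sup>2\<close> after doubling the angles, and expressing
  one factor of each square by the subtraction formula brings in \<open>W\<close>.\<close>

lemma numerator_eq:
  fixes s t :: real
  defines "S \<equiv> sinh (s / 2)" and "T \<equiv> sinh (t / 2)" and "W \<equiv> sinh ((s + t) / 2)"
  shows "t * (s + t) * cosh s - s * (s + t) * cosh t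
      + (s - t) * (s + t + sinh s + sinh t - sinh (s + t))
    = - 2 * ((s + t) * (s * cosh (s / 2) * T * W - t * cosh (t / 2) * S * W
          + (t - s) * cosh ((s + t) / 2) * S * T) + 2 * (s - t) * S * T * W)"
proof -
  define V where "V = cosh ((s + t) / 2)"
  have c: "cosh s = 2 * S\<^sup>2 + 1" "cosh t = 2 * T\<^sup>2 + 1"
    using cosh_double[of "s/2"] cosh_double[of "t/2"] by (simp_all add: S_def T_def cosh_square_eq)
  have T: "T = W * cosh (s / 2) - V * S"
    using sinh_diff[of "(s + t) / 2" "s / 2"] by (simp add: S_def T_def W_def V_def add_divide_distrib)
  have S: "S = W * cosh (t / 2) - V * T"
    using sinh_diff[of "(s + t) / 2" "t / 2"] by (simp add: S_def T_def W_def V_def add_divide_distrib)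
  have h: "sinh s + sinh t - sinh (s + t) = - 4 * S * T * W"
    by (simp add: S_def T_def W_def sinh_half_sum)
  have "t * (s + t) * cosh s - s * (s + t) * cosh t
      + (s - t) * (s + t + sinh s + sinh t - sinh (s + t))
    = (s + t) * (t * (cosh s - 1) - s * (cosh t - 1)) + (s - t) * (sinh s + sinh t - sinh (s + t))"
    by (simp add: algebra_simps)
  also have "\<dots> = 2 * (s + t) * (t * S * S - s * T * T) - 4 * (s - t) * S * T * W"
    unfolding c h by (simp add: algebra_simps power2_eq_square)
  also have "t * S * S - s * T * T
      = t * S * (W * cosh (t / 2) - V * T) - s * T * (W * cosh (s / 2) - V * S)"
    using S T by simp
  finally show ?thesis
    unfolding V_def[symmetric] by (simp add: algebra_simps)
qed

text \<open>Write \<open>Kt0 s / 4\<close> as \<open>coth (s / 2) / s - 2 / s\<^sup>2\<close>. The coefficients of the cotangents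
  combine by partial fractions, and the rational terms add up to
  \<open>2 * (s - t) / (s * t * (s + t)\<^sup>2)\<close>.\<close>

lemma Kt0_differences:
  fixes s t :: real
  assumes "s \<noteq> 0" "t \<noteq> 0" "s + t \<noteq> 0"
  shows "(Kt0 t - Kt0 s) / (s + t) + (Kt0 (s + t) - Kt0 t) / s - (Kt0 (s + t) - Kt0 s) / t
    = 4 * ((s + t) * (s * coth (s / 2) - t * coth (t / 2) + (t - s) * coth ((s + t) / 2))
        + 2 * (s - t)) / (s * t * (s + t)\<^sup>2)"
proof -
  have id: "(4 * (t * y - 2) / t\<^sup>2 - 4 * (s * x - 2) / s\<^sup>2) / w
      + (4 * (w * z - 2) / w\<^sup>2 - 4 * (t * y - 2) / t\<^sup>2) / s
      - (4 * (w * z - 2) / w\<^sup>2 - 4 * (s * x - 2) / s\<^sup>2) / t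
    = 4 * (w * (s * x - t * y + (t - s) * z) + 2 * (s - t)) / (s * t * w\<^sup>2)"
    if w: "w = s + t" for w x y z
  proof -
    have "w \<noteq> 0" using w assms by simp
    then show ?thesis using assms(1,2)
      by (simp add: divide_simps power2_eq_square) (simp add: w algebra_simps)
  qed
  show ?thesis
    using id[OF refl] assms by (simp add: Kt0_nonzero)
qed

lemma regular_identity:
  assumes "s \<noteq> 0" "t \<noteq> 0" "s + t \<noteq> 0"
  shows "4 * (sinh ((s + t) / 2) / (s + t)) *
      ((t * (s + t) * cosh s - s * (s + t) * cosh t
          + (s - t) * (s + t + sinh s + sinh t - sinh (s + t)))
        / (s * t * (s + t) * sinh (s / 2) * sinh (t / 2) * (sinh ((s + t) / 2))\<^sup>2))
    = - 2 * ((Kt0 t - Kt0 s) / (s + t) + (Kt0 (s + t) - Kt0 t) / s - (Kt0 (s + t) - Kt0 s) / t)"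
proof -
  have nz: "sinh (s / 2) \<noteq> 0" "sinh (t / 2) \<noteq> 0" "sinh ((s + t) / 2) \<noteq> 0"
    using assms by simp_all
  have id: "4 * (W / w) * (- 2 * (w * (s * C * T * W - t * D * S * W + (t - s) * V * S * T)
          + 2 * (s - t) * S * T * W) / (s * t * w * S * T * W\<^sup>2))
    = - 2 * (4 * (w * (s * (C / S) - t * (D / T) + (t - s) * (V / W)) + 2 * (s - t)) / (s * t * w\<^sup>2))"
    if "S \<noteq> 0" "T \<noteq> 0" "W \<noteq> 0" "w \<noteq> 0" for S T W C D V w
    using that assms(1,2)
    by (simp add: divide_simps power2_eq_square) (simp add: algebra_simps)
  show ?thesis
    unfolding numerator_eq Kt0_differences[OF assms] coth_def
    by (rule id[OF nz assms(3)])
qed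

section \<open>The identity on the plane\<close>

theorem mainTheorem6:
  shows "continuous_on UNIV Kt0 \<and> continuous_on UNIV Ht0 \<and>
    (\<forall>s1 s2 :: real.
       - (1 / 2) * Ht0 (s1, s2) =
       ext_by_cont regular_pairs
         (\<lambda>(s, t). (Kt0 t - Kt0 s) / (s + t)
                  + (Kt0 (s + t) - Kt0 t) / s
                  - (Kt0 (s + t) - Kt0 s) / t) (s1, s2))"
proof -
  obtain d where d: "\<And>x. (Kt0 has_real_derivative d x) (at x)" and cd: "continuous_on UNIV d"
    using Kt0_C1 by blast
  let ?R = "\<lambda>(s, t). (Kt0 t - Kt0 s) / (s + t)
                  + (Kt0 (s + t) - Kt0 t) / s - (Kt0 (s + t) - Kt0 s) / t"
  define F where "F = (\<lambda>(s, t). divdiff d (t, - s) + divdiff d (s + t, t) - divdiff d (s + t, s))"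
  have F: "continuous_on UNIV F"
    unfolding F_def case_prod_unfold
    by (intro continuous_intros continuous_on_compose2[OF continuous_on_divdiff[OF cd]]) auto
  have R: "?R x = F x" if "x \<in> regular_pairs" for x
  proof (cases x)
    case (Pair s t)
    with that have nz: "s \<noteq> 0" "t \<noteq> 0" "s + t \<noteq> 0" "t \<noteq> - s"
      by (auto simp: regular_pairs_def)
    then show ?thesis
      by (simp add: Pair F_def divdiff_eq[OF d] Kt0_even add.commute)
  qed
  have extR: "ext_by_cont regular_pairs ?R = F"
    by (rule ext_by_cont_eq[OF F closure_regular_pairs R])

  \<comment> \<open>The continuous extension of the factor that distinguishes \<open>Ht0\<close> from \<open>H0\<close>. Because it has no
    zeros, \<open>H0\<close> extends continuously to the whole plane, including the line \<open>s + t = 0\<close>.\<close>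
  let ?\<sigma> = "\<lambda>w. 4 * (exp_rem 1 w / (2 * exp (w / 2)))"
  have \<sigma>: "4 * (sinh (w / 2) / w) = ?\<sigma> w" if "w \<noteq> 0" for w
    using sinh_half_over[OF that] by simp
  have \<sigma>_nz: "?\<sigma> w \<noteq> 0" for w
    using exp_rem_1_nonzero by simp
  have H0: "H0 = (\<lambda>x. - 2 * F x / ?\<sigma> (fst x + snd x))"
    unfolding H0_def
  proof (rule ext_by_cont_eq[OF _ closure_regular_pairs])
    show "continuous_on UNIV (\<lambda>x. - 2 * F x / ?\<sigma> (fst x + snd x))"
      using exp_rem_1_nonzero
      by (intro continuous_intros F continuous_on_compose2[OF continuous_on_exp_rem]) auto
    fix x :: "real \<times> real"
    assume x: "x \<in> regular_pairs"
    obtain s t where st: "x = (s, t)" by (cases x)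
    with x have nz: "s \<noteq> 0" "t \<noteq> 0" "s + t \<noteq> 0"
      by (auto simp: regular_pairs_def)
    have F_st: "(Kt0 t - Kt0 s) / (s + t) + (Kt0 (s + t) - Kt0 t) / s
        - (Kt0 (s + t) - Kt0 s) / t = F (s, t)"
      using R[OF x] by (simp add: st)
    from regular_identity[OF nz, unfolded F_st \<sigma>[OF nz(3)]]
    show "(case x of (s, t) \<Rightarrow>
        (t * (s + t) * cosh s - s * (s + t) * cosh t
          + (s - t) * (s + t + sinh s + sinh t - sinh (s + t)))
        / (s * t * (s + t) * sinh (s / 2) * sinh (t / 2) * (sinh ((s + t) / 2))\<^sup>2))
      = - 2 * F x / ?\<sigma> (fst x + snd x)"
      unfolding st prod.case fst_conv snd_conv
      by (subst nonzero_eq_divide_eq[OF \<sigma>_nz]) (simp only: mult.commute)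
  qed
  have Ht0: "Ht0 = (\<lambda>x. - 2 * F x)"
    unfolding Ht0_def
  proof (rule ext_by_cont_eq)
    show "continuous_on UNIV (\<lambda>x. - 2 * F x)"
      by (intro continuous_intros F)
    have "regular_pairs \<subseteq> {(s, t). s + t \<noteq> 0}"
      by (auto simp: regular_pairs_def)
    from closure_mono[OF this] show "closure {(s, t). s + t \<noteq> (0 :: real)} = UNIV"
      by (auto simp: closure_regular_pairs)
    fix x :: "real \<times> real"
    assume "x \<in> {(s, t). s + t \<noteq> 0}"
    then obtain s t where st: "x = (s, t)" "s + t \<noteq> 0" by auto
    show "(case x of (s, t) \<Rightarrow> 4 * (sinh ((s + t) / 2) / (s + t)) * H0 (s, t)) = - 2 * F x"
      unfolding st(1) prod.case \<sigma>[OF st(2)] H0 fst_conv snd_conv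
      using \<sigma>_nz[of "s + t"] by simp
  qed
  have "continuous_on UNIV Kt0"
    using d by (intro DERIV_continuous_on) (blast intro: has_field_derivative_at_within)
  moreover have "continuous_on UNIV Ht0"
    unfolding Ht0 by (intro continuous_intros F)
  ultimately show ?thesis
    by (simp add: extR Ht0)
qed

end
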